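(* Let $r \geq 2$ be an integer, let $0 \leq j < r$, and let $\delta \in -2\pi i\,\mathbf{H}$ (equivalently, $\delta$ is a complex number with $\operatorname{Re}\delta > 0$; in particular this covers $\delta = \log(p^m)$, i.e. $e^\delta = p^m$ any prime power). Then the generalized Galois numbers satisfy $$\lim_{n \rightarrow \infty} G^{(r)}_{rn + j}(e^\delta) \cdot e^{- u_j(r,n)\, \delta} = \frac{ \Theta_{F_j} \left(-\frac{\delta}{2 \pi i}\right)}{\phi(e^{-\delta})^{r-1}} .$$ Here $\phi(x) = \prod_{m=1}^\infty (1-x^{m})$, and $\Theta_{F_j}(z) = \sum_{\mathbf{k} \in \mathbf{Z}^{r-1}} e^{2 \pi i z F_j(\mathbf{k})}$ for $z\in\mathbf{H}$, where for $\mathbf{k}=(k_1,\ldots,k_{r-1})$ $$F_0 (k_1,\ldots , k_{r-1}) = \sum_{l=1}^{r-1} k_l^2 - \sum_{l=1}^{r-2} k_l k_{l+1},$$ $$F_j (k_1,\ldots , k_{r-1}) = \left( k_j + \tfrac 12 \right)^2 + \sum_{l=1,\, l \neq j}^{r-1} k_l^2 - \sum_{l=1}^{r-2} k_l k_{l+1} \qquad (1\le j\le r-1),$$ and the exponents are $$u_0(r,n) = \frac{r(r-1)n^2}{2},$$ $$u_j(r,n) = \frac{(rn+j)(rn+j-1)}{2} - \frac{rn(rn+2j-r)}{2r} + \frac 14 \qquad (1\le j\le r-1).$$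
   Context: $\mathbf{H}$ is the open upper half plane in $\mathbf{C}$. For integers $r\ge 1$, $N\ge 0$, the generalized Galois number is the polynomial in $q$ with nonnegative integer coefficients $$G_N^{(r)}(q) = \sum_{\substack{(k_1,\ldots,k_r) \in \mathbf{Z}_{\ge 0}^{r}\\ k_1 + \cdots + k_r =N}} \begin{bmatrix} N \\ k_1,\ldots,k_r\end{bmatrix}_q ,$$ where $\begin{bmatrix} N \\ k_1,\ldots,k_r\end{bmatrix}_q = \frac{[N]_q!}{[k_1]_q!\cdots[k_r]_q!}$ is the $q$-multinomial coefficient, with $[m]_q! = \prod_{i=1}^m (1+q+\cdots+q^{i-1})$. When $q$ is a prime power, $G_N^{(r)}(q)$ is the number of flags $0=V_0\subseteq V_1\subseteq\cdots\subseteq V_r=\mathbf{F}_q^N$ of length $r$. For complex $e^\delta$, $G_N^{(r)}(e^\delta)$ is the value of this polynomial at $e^\delta$. *)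

theory Defs
  imports "HOL-Analysis.Analysis" "HOL-Computational_Algebra.Polynomial"
begin

text \<open>
  Vectors indexed by \<open>1, \<dots>, d\<close> are the extensional functions
  \<open>{1..d} \<rightarrow>\<^sub>E UNIV\<close>, so that each vector is counted exactly once.
\<close>

definition q_fact :: "nat \<Rightarrow> int poly" where
  "q_fact m = (\<Prod>i=1..m. \<Sum>l<i. monom 1 l)"

text \<open>
  The quotient below is an exact division in \<open>\<int>[q]\<close>: see \<open>q_multinomial_mult\<close>.
\<close>

definition q_multinomial :: "nat \<Rightarrow> nat \<Rightarrow> (nat \<Rightarrow> nat) \<Rightarrow> int poly" where
  "q_multinomial r N k = q_fact N div (\<Prod>i=1..r. q_fact (k i))"

definition galois_poly :: "nat \<Rightarrow> nat \<Rightarrow> int poly" where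
  "galois_poly r N =
     (\<Sum>k | k \<in> {1..r} \<rightarrow>\<^sub>E UNIV \<and> (\<Sum>i=1..r. k i) = N. q_multinomial r N k)"

definition galois_number :: "nat \<Rightarrow> nat \<Rightarrow> complex \<Rightarrow> complex" where
  "galois_number r N x = poly (map_poly of_int (galois_poly r N)) x"

definition upper_half_plane :: "complex set" where
  "upper_half_plane = {z. Im z > 0}"

definition phi :: "complex \<Rightarrow> complex" where
  "phi x = (\<Prod>m. 1 - x ^ Suc m)"

definition theta :: "nat \<Rightarrow> ((nat \<Rightarrow> int) \<Rightarrow> real) \<Rightarrow> complex \<Rightarrow> complex" where
  "theta d F z =
     (\<Sum>\<^sub>\<infinity>k\<in>{1..d} \<rightarrow>\<^sub>E UNIV. exp (2 * of_real pi * \<i> * z * of_real (F k)))"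

definition F_form :: "nat \<Rightarrow> nat \<Rightarrow> (nat \<Rightarrow> int) \<Rightarrow> real" where
  "F_form r j k =
     (if j = 0
      then (\<Sum>l=1..r-1. (real_of_int (k l))\<^sup>2)
             - (\<Sum>l=1..r-2. real_of_int (k l) * real_of_int (k (l + 1)))
      else (real_of_int (k j) + 1/2)\<^sup>2
             + (\<Sum>l\<in>{1..r-1} - {j}. (real_of_int (k l))\<^sup>2)
             - (\<Sum>l=1..r-2. real_of_int (k l) * real_of_int (k (l + 1))))"

definition u_exp :: "nat \<Rightarrow> nat \<Rightarrow> nat \<Rightarrow> real" where
  "u_exp j r n =
     (if j = 0
      then real r * (real r - 1) * (real n)\<^sup>2 / 2
      else (real r * real n + real j) * (real r * real n + real j - 1) / 2
             - real r * real n * (real r * real n + 2 * real j - real r) / (2 * real r)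
             + 1/4)"

lemma q_fact_0 [simp]: "q_fact 0 = 1"
  by (simp add: q_fact_def)

lemma q_fact_Suc: "q_fact (Suc m) = q_fact m * (\<Sum>l<Suc m. monom 1 l)"
  unfolding q_fact_def by (subst prod.nat_ivl_Suc') (auto simp: mult.commute)

lemma sum_monom_add:
  "(\<Sum>l<a + b. monom (1::int) l) = (\<Sum>l<a. monom 1 l) + monom 1 a * (\<Sum>l<b. monom 1 l)"
  by (induction b) (auto simp: algebra_simps mult_monom)

lemma q_fact_nonzero: "q_fact m \<noteq> 0"
proof -
  have "(\<Sum>l<i. monom (1::int) l) \<noteq> 0" if "i \<ge> 1" for i
  proof
    assume "(\<Sum>l<i. monom (1::int) l) = 0"
    hence "coeff (\<Sum>l<i. monom (1::int) l) 0 = 0" by simp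
    thus False using that by (auto simp: coeff_sum if_distrib sum.delta)
  qed
  thus ?thesis unfolding q_fact_def by (subst prod_zero_iff) auto
qed

lemma q_fact_mult_dvd: "q_fact a * q_fact b dvd q_fact (a + b)"
proof (induction "a + b" arbitrary: a b)
  case (Suc n)
  show ?case
  proof (cases a; cases b)
    fix a' b' assume ab: "a = Suc a'" "b = Suc b'"
    have eq: "q_fact (a + b) = q_fact (a' + b) * (\<Sum>l<a. monom 1 l)
            + monom 1 a * (q_fact (a + b') * (\<Sum>l<b. monom 1 l))"
      using sum_monom_add[of a b] by (simp add: ab q_fact_Suc algebra_simps)
    have "q_fact a' * q_fact b dvd q_fact (a' + b)" "q_fact a * q_fact b' dvd q_fact (a + b')"
      using Suc(1)[of a' b] Suc(1)[of a b'] Suc(2) ab by simp_all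
    hence "q_fact a' * q_fact b * (\<Sum>l<a. monom 1 l) dvd q_fact (a' + b) * (\<Sum>l<a. monom 1 l)"
      and "q_fact a * q_fact b' * (\<Sum>l<b. monom 1 l) dvd q_fact (a + b') * (\<Sum>l<b. monom 1 l)"
      by (auto intro: mult_dvd_mono)
    moreover have "q_fact a' * q_fact b * (\<Sum>l<a. monom 1 l) = q_fact a * q_fact b"
      and "q_fact a * q_fact b' * (\<Sum>l<b. monom 1 l) = q_fact a * q_fact b"
      unfolding ab q_fact_Suc by (simp_all only: mult_ac)
    ultimately show ?thesis unfolding eq by (metis dvd_add dvd_mult)
  qed auto
qed auto

lemma prod_q_fact_dvd: "finite I \<Longrightarrow> (\<Prod>i\<in>I. q_fact (k i)) dvd q_fact (\<Sum>i\<in>I. k i)"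
  by (induction I rule: finite_induct)
     (auto intro: dvd_trans[OF mult_dvd_mono[OF dvd_refl] q_fact_mult_dvd])

lemma q_multinomial_mult:
  assumes "(\<Sum>i=1..r. k i) = N"
  shows "q_multinomial r N k * (\<Prod>i=1..r. q_fact (k i)) = q_fact N"
  unfolding q_multinomial_def using prod_q_fact_dvd[of "{1..r}" k] assms by simp

lemma finite_galois_index: "finite {k \<in> {1..r::nat} \<rightarrow>\<^sub>E UNIV. (\<Sum>i=1..r. k i) = (N::nat)}"
proof (rule finite_subset)
  show "{k \<in> {1..r} \<rightarrow>\<^sub>E UNIV. (\<Sum>i=1..r. k i) = N} \<subseteq> {1..r} \<rightarrow>\<^sub>E {..N}"
  proof
    fix k assume k: "k \<in> {k \<in> {1..r} \<rightarrow>\<^sub>E UNIV. (\<Sum>i=1..r. k i) = N}"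
    have "k i \<le> N" if "i \<in> {1..r}" for i
      using member_le_sum[OF that, of k] k by simp
    thus "k \<in> {1..r} \<rightarrow>\<^sub>E {..N}" using k by (auto simp: PiE_iff)
  qed
qed (auto intro: finite_PiE)

lemma mem_upper_half_plane_image_iff:
  "\<delta> \<in> (\<lambda>z. - 2 * of_real pi * \<i> * z) ` upper_half_plane \<longleftrightarrow> Re \<delta> > 0"
proof
  assume "Re \<delta> > 0"
  moreover have "\<delta> = - 2 * of_real pi * \<i> * (\<i> * \<delta> / (2 * of_real pi))"
    by (simp add: field_simps)
  moreover have "Im (\<i> * \<delta> / (2 * of_real pi)) = Re \<delta> / (2 * pi)"
    using Im_divide_of_real[of "\<i> * \<delta>" "2 * pi"] by simp
  ultimately show "\<delta> \<in> (\<lambda>z. - 2 * of_real pi * \<i> * z) ` upper_half_plane"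
    by (intro image_eqI[where x = "\<i> * \<delta> / (2 * of_real pi)"])
       (simp_all only: upper_half_plane_def mem_Collect_eq, simp)
qed (auto simp: upper_half_plane_def)

end

theory Submission imports Defs begin

text \<open>
  Put \<open>x = e\<^sup>-\<^sup>\<delta>\<close> and \<open>(x)\<^sub>m = (1 - x) \<dots> (1 - x\<^sup>m)\<close>. At \<open>q = 1/x\<close> the \<open>q\<close>-multinomial coefficient is a power of
  \<open>q\<close> times \<open>(x)\<^sub>N / \<Prod>\<^sub>i (x)\<^bsub>K\<^sub>i\<^esub>\<close>, and in terms of the deviations of the \<open>K\<^sub>i\<close> from their common
  size \<open>n\<close> the exponent is the normalising \<open>u\<^sub>j(r,n)\<close> minus the quadratic form \<open>F\<^sub>j\<close>. For each fixed deviation the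
  quotient tends to \<open>\<phi>(x) / \<phi>(x)\<^sup>r\<close>; it is bounded uniformly, and the theta series converges absolutely,
  so limit and summation may be exchanged by dominated convergence.
\<close>

text \<open>Tannery's theorem. The majorant \<open>M\<close> makes the finite partial sums converge
  uniformly in \<open>n\<close> (Weierstrass), so the limits over \<open>n\<close> and over finite
  subsets may be swapped.\<close>

lemma tannery_infsum:
  fixes f :: "nat \<Rightarrow> 'a \<Rightarrow> 'b :: banach"
  assumes bound: "\<And>n x. x \<in> A \<Longrightarrow> norm (f n x) \<le> M x"
    and M: "M summable_on A"
    and lim: "\<And>x. x \<in> A \<Longrightarrow> (\<lambda>n. f n x) \<longlonglongrightarrow> g x"
  shows "(\<lambda>n. infsum (f n) A) \<longlonglongrightarrow> infsum g A"
proof (rule swap_uniform_limit')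
  show "uniform_limit UNIV (\<lambda>X n. \<Sum>x\<in>X. f n x) (\<lambda>n. infsum (f n) A) (finite_subsets_at_top A)"
    using Weierstrass_m_test_general[where X = A and Y = UNIV and f = "\<lambda>x n. f n x" and M = M]
      bound M by simp
  show "\<forall>\<^sub>F X in finite_subsets_at_top A. (\<lambda>n. \<Sum>x\<in>X. f n x) \<longlonglongrightarrow> (\<Sum>x\<in>X. g x)"
    by (rule eventually_finite_subsets_at_top_weakI) (auto intro!: tendsto_sum lim)
  \<comment> \<open>The bound passes to the limit, so \<open>g\<close> is summable and
    \<open>infsum g A\<close> is a genuine limit rather than the default 0.\<close>
  have "norm (g x) \<le> M x" if "x \<in> A" for x
    by (rule tendsto_upperbound[OF tendsto_norm[OF lim[OF that]]]) (use bound that in auto)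
  then have "(\<lambda>x. norm (g x)) summable_on A"
    by (rule Infinite_Sum.abs_summable_on_comparison_test'[OF M])
  then have "g summable_on A"
    by (rule abs_summable_summable)
  then show "(sum g \<longlongrightarrow> infsum g A) (finite_subsets_at_top A)"
    using has_sum_infsum has_sum_def by blast
qed auto

section \<open>The finite \<open>q\<close>-Pochhammer symbol\<close>

definition qpoch :: "complex \<Rightarrow> nat \<Rightarrow> complex" where
  "qpoch x m = (\<Prod>i<m. 1 - x ^ Suc i)"

lemma one_minus_power_nonzero:
  fixes x :: complex
  assumes "norm x < 1"
  shows "1 - x ^ Suc i \<noteq> 0"
proof
  assume "1 - x ^ Suc i = 0"
  then have "norm (x ^ Suc i) = 1" by simp
  moreover have "norm (x ^ Suc i) < 1"
    unfolding norm_power using assms by (subst power_less_one_iff) auto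
  ultimately show False by simp
qed

lemma qpoch_nonzero: "norm x < 1 \<Longrightarrow> qpoch x m \<noteq> 0"
  using one_minus_power_nonzero by (auto simp: qpoch_def)

lemma convergent_prod_phi:
  fixes x :: complex
  assumes "norm x < 1"
  shows "convergent_prod (\<lambda>m. 1 - x ^ Suc m)"
proof -
  have "summable (\<lambda>m. norm ((1 - x ^ Suc m) - 1))"
    using summable_mult[OF summable_geometric[of "norm x"], of "norm x"] assms
    by (simp add: norm_mult norm_power)
  then show ?thesis
    by (intro abs_convergent_prod_imp_convergent_prod summable_imp_abs_convergent_prod)
qed

lemma qpoch_tendsto_phi:
  assumes "norm x < 1"
  shows "qpoch x \<longlonglongrightarrow> phi x"
proof -
  \<comment> \<open>The partial products of \<open>convergent_prod_LIMSEQ\<close> run over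
    \<open>{..n}\<close> and have \<open>n + 1\<close> factors, hence the shift.\<close>
  have "(\<lambda>n. qpoch x (Suc n)) \<longlonglongrightarrow> phi x"
    using convergent_prod_LIMSEQ[OF convergent_prod_phi[OF assms]]
    by (simp add: qpoch_def phi_def lessThan_Suc_atMost)
  then show ?thesis by (rule LIMSEQ_imp_Suc)
qed

text \<open>Convergence in the sense of \<open>convergent_prod\<close> excludes a product of nonzero
  factors tending to 0. This is what gives the inverses of \<open>qpoch x m\<close> a limit and a
  uniform bound.\<close>

lemma phi_nonzero:
  assumes "norm x < 1"
  shows "phi x \<noteq> 0"
  unfolding phi_def
  by (rule prodinf_nonzero[OF convergent_prod_phi[OF assms] one_minus_power_nonzero[OF assms]])

section \<open>Evaluation of \<open>q\<close>-multinomial coefficients\<close>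

text \<open>The evaluation inside \<open>galois_number\<close>. The rules below make it a ring
  homomorphism, so the division-free identity \<open>q_multinomial_mult\<close> can be carried over
  to complex numbers.\<close>

definition eval_int :: "complex \<Rightarrow> int poly \<Rightarrow> complex" where
  "eval_int x p = poly (map_poly of_int p) x"

lemma eval_int_pCons [simp]: "eval_int x (pCons a p) = of_int a + x * eval_int x p"
  by (simp add: eval_int_def map_poly_pCons)

lemma eval_int_0 [simp]: "eval_int x 0 = 0"
  by (simp add: eval_int_def)

lemma eval_int_1 [simp]: "eval_int x 1 = 1"
  by (simp add: eval_int_def)

lemma eval_int_add [simp]: "eval_int x (p + p') = eval_int x p + eval_int x p'"
  by (induction p p' rule: poly_induct2) (auto simp: algebra_simps)

lemma eval_int_smult [simp]: "eval_int x (smult a p) = of_int a * eval_int x p"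
  by (induction p) (auto simp: algebra_simps)

lemma eval_int_mult [simp]: "eval_int x (p * p') = eval_int x p * eval_int x p'"
  by (induction p) (auto simp: algebra_simps)

lemma eval_int_monom [simp]: "eval_int x (monom a n) = of_int a * x ^ n"
  by (simp add: eval_int_def map_poly_monom poly_monom)

lemma eval_int_sum [simp]: "eval_int x (sum f A) = (\<Sum>a\<in>A. eval_int x (f a))"
  by (induction A rule: infinite_finite_induct) auto

lemma eval_int_prod [simp]: "eval_int x (prod f A) = (\<Prod>a\<in>A. eval_int x (f a))"
  by (induction A rule: infinite_finite_induct) auto

text \<open>For \<open>q = exp \<delta> = 1/x\<close>, the i-th factor times \<open>1 - x\<close> is
  \<open>q^(i-1) * (1 - x^i)\<close>, and the exponents 0, ..., m-1 add up to
  \<open>m * (m - 1) / 2\<close>.\<close>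

lemma eval_q_fact:
  fixes \<delta> :: complex
  defines "x \<equiv> exp (- \<delta>)"
  shows "eval_int (exp \<delta>) (q_fact m) * (1 - x) ^ m
           = exp (of_nat (m * (m - 1)) / 2 * \<delta>) * qpoch x m"
proof (induction m)
  case 0
  show ?case by (simp add: qpoch_def)
next
  case (Suc m)
  have inv: "exp \<delta> * x = 1"
    by (simp add: x_def exp_minus)
  \<comment> \<open>Since \<open>q^(l+1) * x = q^l\<close>, multiplying by \<open>1 - x\<close>
    telescopes: only the top power and \<open>- x\<close> survive.\<close>
  have geo: "(\<Sum>l<Suc m. exp \<delta> ^ l) * (1 - x) = exp \<delta> ^ m - x" for m
  proof (induction m)
    case (Suc m)
    have "exp \<delta> ^ Suc m * x = exp \<delta> ^ m"
      using inv by (simp add: mult.assoc mult.left_commute)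
    moreover have "(\<Sum>l<Suc (Suc m). exp \<delta> ^ l) * (1 - x)
        = (\<Sum>l<Suc m. exp \<delta> ^ l) * (1 - x) + (exp \<delta> ^ Suc m - exp \<delta> ^ Suc m * x)"
      by (subst sum.lessThan_Suc) (simp only: algebra_simps mult_1_left)
    ultimately show ?case
      unfolding Suc.IH by simp
  qed simp
  have "exp \<delta> ^ m * x ^ m = 1"
    using inv by (simp add: power_mult_distrib[symmetric])
  then have step: "(\<Sum>l<Suc m. exp \<delta> ^ l) * (1 - x) = exp (of_nat m * \<delta>) * (1 - x ^ Suc m)"
    unfolding geo exp_of_nat_mult by (simp add: algebra_simps)
  have "of_nat (Suc m * (Suc m - 1)) / 2 * \<delta> = of_nat (m * (m - 1)) / 2 * \<delta> + of_nat m * \<delta>"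
    by (cases m) (simp_all add: field_simps)
  then have ex: "exp (of_nat (Suc m * (Suc m - 1)) / 2 * \<delta>)
      = exp (of_nat (m * (m - 1)) / 2 * \<delta>) * exp (of_nat m * \<delta>)"
    by (simp only: exp_add)
  have "eval_int (exp \<delta>) (q_fact (Suc m)) * (1 - x) ^ Suc m
      = (eval_int (exp \<delta>) (q_fact m) * (1 - x) ^ m) * ((\<Sum>l<Suc m. exp \<delta> ^ l) * (1 - x))"
    by (simp only: q_fact_Suc eval_int_mult eval_int_sum eval_int_monom power_Suc of_int_1
        mult_1_left mult_ac)
  also have "\<dots> = exp (of_nat (Suc m * (Suc m - 1)) / 2 * \<delta>) * qpoch x (Suc m)"
    unfolding Suc.IH step ex by (simp add: qpoch_def mult_ac)
  finally show ?case .
qed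

text \<open>\<open>eval_q_fact\<close> is applied to both sides of
  \<open>q_multinomial_mult\<close>. Because the parts add up to \<open>N\<close>, the powers of
  \<open>1 - x\<close> on the two sides agree and cancel.\<close>

lemma eval_q_multinomial:
  fixes \<delta> :: complex
  defines "x \<equiv> exp (- \<delta>)"
  assumes x: "norm x < 1" and K: "(\<Sum>i=1..r. K i) = N"
  shows "eval_int (exp \<delta>) (q_multinomial r N K)
           = exp ((of_nat (N * (N - 1)) - (\<Sum>i=1..r. of_nat (K i * (K i - 1)))) / 2 * \<delta>)
             * (qpoch x N * (\<Prod>i=1..r. inverse (qpoch x (K i))))"
proof -
  let ?E = "\<lambda>m. exp (of_nat (m * (m - 1)) / 2 * \<delta>)"
  have "1 - x \<noteq> 0"
    using x by auto
  have nz: "(\<Prod>i=1..r. qpoch x (K i)) \<noteq> 0" "(\<Prod>i=1..r. ?E (K i)) \<noteq> 0"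
    using qpoch_nonzero[OF x] by auto
  have pow: "(1 - x) ^ N = (\<Prod>i=1..r. (1 - x) ^ K i)"
    by (simp add: K[symmetric] power_sum)
  have "eval_int (exp \<delta>) (q_multinomial r N K) * ((\<Prod>i=1..r. ?E (K i)) * (\<Prod>i=1..r. qpoch x (K i)))
      = eval_int (exp \<delta>) (q_multinomial r N K)
        * (\<Prod>i=1..r. eval_int (exp \<delta>) (q_fact (K i)) * (1 - x) ^ K i)"
    using eval_q_fact[of \<delta>] by (simp add: x_def prod.distrib)
  also have "\<dots> = eval_int (exp \<delta>) (q_multinomial r N K * (\<Prod>i=1..r. q_fact (K i))) * (1 - x) ^ N"
    by (simp add: pow prod.distrib mult.assoc)
  also have "\<dots> = ?E N * qpoch x N"
    unfolding q_multinomial_mult[OF K] using eval_q_fact[of \<delta> N] by (simp add: x_def)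
  finally have "eval_int (exp \<delta>) (q_multinomial r N K)
      = ?E N / (\<Prod>i=1..r. ?E (K i)) * (qpoch x N * inverse (\<Prod>i=1..r. qpoch x (K i)))"
    using nz by (simp add: field_simps)
  also have "?E N / (\<Prod>i=1..r. ?E (K i))
      = exp ((of_nat (N * (N - 1)) - (\<Sum>i=1..r. of_nat (K i * (K i - 1)))) / 2 * \<delta>)"
    by (simp add: exp_sum[symmetric] exp_diff[symmetric] diff_divide_distrib left_diff_distrib
        sum_divide_distrib sum_distrib_right)
  finally show ?thesis
    by (simp add: prod_inversef[symmetric] o_def)
qed

section \<open>Compositions near the centre\<close>

text \<open>
  A composition \<open>K\<close> of \<open>r n + j\<close> is written as \<open>K\<^sub>i = n + d\<^sub>i\<close>, and the deviations, which sum to \<open>j\<close>,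
  are parametrised by \<open>\<int>\<^sup>r\<^sup>-\<^sup>1\<close> through \<open>d\<^sub>i = k\<^sub>i - k\<^sub>i\<^sub>-\<^sub>1 + [i \<le> j]\<close> with \<open>k\<^sub>0 = k\<^sub>r = 0\<close>.
\<close>

definition pad :: "nat \<Rightarrow> (nat \<Rightarrow> int) \<Rightarrow> nat \<Rightarrow> int" where
  "pad r k i = (if i \<in> {1..r - 1} then k i else 0)"

definition deviation :: "nat \<Rightarrow> nat \<Rightarrow> (nat \<Rightarrow> int) \<Rightarrow> nat \<Rightarrow> int" where
  "deviation r j k i = pad r k i - pad r k (i - 1) + (if i \<le> j then 1 else 0)"

text \<open>The differences telescope. At \<open>l = r\<close> this gives the total \<open>j\<close>
  (for \<open>j < r\<close>); at smaller \<open>l\<close> it recovers \<open>k l\<close>, so the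
  parametrisation can be inverted.\<close>

lemma sum_deviation: "(\<Sum>i=1..l. deviation r j k i) = pad r k l + int (min l j)"
  by (induction l) (auto simp: deviation_def pad_def min_def)

text \<open>Each inner \<open>e i\<close> is squared in two neighbouring differences,
  \<open>e s\<close> in only one; the mixed terms are the consecutive products, the one with
  \<open>e 0\<close> being zero.\<close>

lemma sum_square_differences:
  fixes e :: "nat \<Rightarrow> real"
  assumes "e 0 = 0"
  shows "(\<Sum>i=1..s. (e i - e (i - 1))\<^sup>2)
           = 2 * (\<Sum>i=1..s. (e i)\<^sup>2) - (e s)\<^sup>2 - 2 * (\<Sum>l=1..s-1. e l * e (l + 1))"
proof (induction s)
  case (Suc s)
  then show ?case
    using assms by (cases s) (simp_all add: power2_eq_square algebra_simps)
qed (simp add: assms)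

text \<open>Expanding the squared deviations gives twice the form \<open>F_form r 0\<close>, a cross
  term \<open>2 * k j\<close> and the constant \<open>j\<close>. For \<open>j > 0\<close> the linear
  term completes the square of \<open>k j + 1/2\<close>, at the cost of 1/4.\<close>

lemma F_form_deviation:
  assumes "r \<ge> 2" "j < r"
  shows "F_form r j k = ((\<Sum>i=1..r. (real_of_int (deviation r j k i))\<^sup>2) - real j) / 2
           + (if j = 0 then 0 else 1/4)"
proof -
  define e where "e i = real_of_int (pad r k i)" for i
  define c where "c i = (if i \<le> j then 1 else 0 :: real)" for i
  obtain s where s: "r = Suc (Suc s)"
    using assms by (metis add_2_eq_Suc less_eqE)
  have e0: "e 0 = 0" and er: "e r = 0"
    by (auto simp: e_def pad_def)
  \<comment> \<open>The indicator \<open>c\<close> cuts the telescoping sum off at \<open>j\<close>;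
    this is the source of the linear term.\<close>
  have "(\<Sum>i=1..l. (e i - e (i - 1)) * c i) = e (min l j)" for l
    by (induction l) (auto simp: c_def e0 min_def not_less_eq_eq le_Suc_eq)
  then have cross: "(\<Sum>i=1..r. (e i - e (i - 1)) * c i) = e j"
    using assms by (simp add: min_def)
  have csq: "(\<Sum>i=1..l. (c i)\<^sup>2) = real (min l j)" for l
    by (induction l) (auto simp: c_def min_def)
  have "(\<Sum>i=1..r. (real_of_int (deviation r j k i))\<^sup>2)
      = (\<Sum>i=1..r. (e i - e (i - 1))\<^sup>2 + 2 * ((e i - e (i - 1)) * c i) + (c i)\<^sup>2)"
    by (intro sum.cong) (auto simp: deviation_def e_def c_def power2_eq_square algebra_simps)
  also have "\<dots> = 2 * (\<Sum>i=1..r. (e i)\<^sup>2) - 2 * (\<Sum>l=1..r-1. e l * e (l + 1)) + 2 * e j + real j"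
    using sum_square_differences[of e r, OF e0] csq[of r] cross assms
    by (simp add: sum.distrib sum_distrib_left[symmetric] er)
  also have "(\<Sum>i=1..r. (e i)\<^sup>2) = (\<Sum>i=1..r-1. (e i)\<^sup>2)"
    using er s by simp
  also have "(\<Sum>l=1..r-1. e l * e (l + 1)) = (\<Sum>l=1..r-2. e l * e (l + 1))"
    using er s by simp
  finally have dev: "((\<Sum>i=1..r. (real_of_int (deviation r j k i))\<^sup>2) - real j) / 2
      = (\<Sum>i=1..r-1. (e i)\<^sup>2) - (\<Sum>l=1..r-2. e l * e (l + 1)) + e j"
    by simp
  have sq: "(\<Sum>l\<in>I. (real_of_int (k l))\<^sup>2) = (\<Sum>l\<in>I. (e l)\<^sup>2)" if "I \<subseteq> {1..r-1}" for I
    using that by (intro sum.cong) (auto simp: e_def pad_def)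
  have pr: "(\<Sum>l=1..r-2. real_of_int (k l) * real_of_int (k (l + 1))) = (\<Sum>l=1..r-2. e l * e (l + 1))"
    by (intro sum.cong) (auto simp: e_def pad_def)
  show ?thesis
  proof (cases "j = 0")
    case True
    then show ?thesis
      unfolding dev F_form_def sq[OF subset_refl] pr by (simp add: e0)
  next
    case False
    then have j: "j \<in> {1..r-1}" and kj: "real_of_int (k j) = e j"
      using assms by (auto simp: e_def pad_def)
    have "F_form r j k = (e j + 1/2)\<^sup>2 + (\<Sum>l\<in>{1..r-1} - {j}. (e l)\<^sup>2)
        - (\<Sum>l=1..r-2. e l * e (l + 1))"
      using False unfolding F_form_def sq[OF Diff_subset] pr kj by simp
    moreover have "(\<Sum>l=1..r-1. (e l)\<^sup>2) = (e j)\<^sup>2 + (\<Sum>l\<in>{1..r-1} - {j}. (e l)\<^sup>2)"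
      using j by (simp add: sum.remove)
    ultimately show ?thesis
      unfolding dev using False by (simp add: power2_eq_square algebra_simps)
  qed
qed

text \<open>The parameters for which \<open>nat\<close> in \<open>composition\<close> truncates
  nothing. Every fixed parameter vector belongs to this set for all large \<open>n\<close>.\<close>

definition admissible :: "nat \<Rightarrow> nat \<Rightarrow> nat \<Rightarrow> (nat \<Rightarrow> int) set" where
  "admissible r j n = {k \<in> {1..r - 1} \<rightarrow>\<^sub>E UNIV. \<forall>i\<in>{1..r}. 0 \<le> int n + deviation r j k i}"

definition composition :: "nat \<Rightarrow> nat \<Rightarrow> nat \<Rightarrow> (nat \<Rightarrow> int) \<Rightarrow> nat \<Rightarrow> nat" where
  "composition r j n k = (\<lambda>i\<in>{1..r}. nat (int n + deviation r j k i))"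

lemma sum_composition:
  assumes "j < r" "k \<in> admissible r j n"
  shows "(\<Sum>i=1..r. composition r j n k i) = r * n + j"
proof -
  have "int (\<Sum>i=1..r. composition r j n k i) = (\<Sum>i=1..r. int n + deviation r j k i)"
    using assms(2) by (auto simp: composition_def admissible_def intro!: sum.cong)
  also have "\<dots> = int (r * n) + (\<Sum>i=1..r. deviation r j k i)"
    by (simp add: sum.distrib)
  also have "\<dots> = int (r * n + j)"
    using assms(1) unfolding sum_deviation by (simp add: pad_def)
  finally show ?thesis
    by linarith
qed

lemma bij_betw_composition:
  assumes "j < r"
  shows "bij_betw (composition r j n) (admissible r j n)
           {K \<in> {1..r} \<rightarrow>\<^sub>E UNIV. (\<Sum>i=1..r. K i) = r * n + j}" (is "bij_betw _ _ ?S")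
proof -
  \<comment> \<open>\<open>sum_deviation\<close> solved for \<open>k l\<close>. It vanishes at both
    ends 0 and \<open>r\<close>, in agreement with \<open>pad\<close>.\<close>
  define p where "p K l = (\<Sum>i=1..l. int (K i) - int n) - int (min l j)" for K l
  define g where "g K = (\<lambda>l\<in>{1..r-1}. p K l)" for K
  \<comment> \<open>This identity yields both that \<open>g K\<close> is admissible and that
    \<open>composition\<close> undoes \<open>g\<close>.\<close>
  have dev: "int n + deviation r j (g K) i = int (K i)" if K: "K \<in> ?S" and i: "i \<in> {1..r}" for K i
  proof -
    have "p K 0 = 0"
      by (simp add: p_def)
    have "(\<Sum>i=1..r. int (K i) - int n) = int (\<Sum>i=1..r. K i) - int (r * n)"
      by (simp add: sum_subtractf)
    also have "(\<Sum>i=1..r. K i) = r * n + j"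
      using K by simp
    finally have "p K r = 0"
      using assms by (simp add: p_def)
    with \<open>p K 0 = 0\<close> have pad: "pad r (g K) l = p K l" if "l \<le> r" for l
      using that by (cases "l = 0"; cases "l = r") (auto simp: pad_def g_def)
    obtain l where l: "i = Suc l"
      using i by (cases i) auto
    show ?thesis
      using i pad[of i] pad[of l] unfolding deviation_def by (auto simp: l p_def min_def)
  qed
  show ?thesis
  proof (rule bij_betwI[where g = g])
    show "composition r j n \<in> admissible r j n \<rightarrow> ?S"
      using sum_composition[OF assms] by (auto simp: composition_def)
    show "g \<in> ?S \<rightarrow> admissible r j n"
      using dev by (auto simp: admissible_def g_def)
  next
    fix k assume k: "k \<in> admissible r j n"
    have "p (composition r j n k) l = k l" if l: "l \<in> {1..r-1}" for l
    proof -
      have "(\<Sum>i=1..l. int (composition r j n k i) - int n) = (\<Sum>i=1..l. deviation r j k i)"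
        using k l by (intro sum.cong) (auto simp: composition_def admissible_def)
      then show ?thesis
        using l unfolding p_def sum_deviation by (simp add: pad_def)
    qed
    then show "g (composition r j n k) = k"
      using k by (auto simp: g_def admissible_def PiE_iff extensional_def fun_eq_iff)
  next
    fix K assume K: "K \<in> ?S"
    then show "composition r j n (g K) = K"
      using dev[OF K] by (auto simp: composition_def fun_eq_iff PiE_iff extensional_def)
  qed
qed

lemma finite_admissible: "j < r \<Longrightarrow> finite (admissible r j n)"
  using bij_betw_finite[OF bij_betw_composition] finite_galois_index by blast

text \<open>Since the deviations add up to \<open>j\<close>, the terms linear in them depend on
  \<open>n\<close> and \<open>j\<close> only. They go into \<open>u_exp\<close>, the squares into
  \<open>F_form\<close>, and the two summands 1/4 cancel.\<close>

lemma exponent_composition: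
  assumes "r \<ge> 2" "j < r" "k \<in> admissible r j n"
  defines "N \<equiv> r * n + j"
  shows "(real (N * (N - 1)) - (\<Sum>i=1..r. real (composition r j n k i * (composition r j n k i - 1)))) / 2
           = u_exp j r n - F_form r j k"
proof -
  define d where "d i = real_of_int (deviation r j k i)" for i
  have pred: "real (m * (m - 1)) = (real m)\<^sup>2 - real m" for m
    by (cases m) (simp_all add: power2_eq_square algebra_simps)
  have comp: "real (composition r j n k i) = real n + d i" if "i \<in> {1..r}" for i
    using that assms(3) by (auto simp: composition_def admissible_def d_def)
  have "real_of_int (\<Sum>i=1..r. deviation r j k i) = real j"
    using assms(2) unfolding sum_deviation by (simp add: pad_def)
  then have sd: "(\<Sum>i=1..r. d i) = real j"
    by (simp add: d_def)
  have "(\<Sum>i=1..r. real (composition r j n k i * (composition r j n k i - 1)))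
      = (\<Sum>i=1..r. (real n)\<^sup>2 - real n + (2 * real n - 1) * d i + (d i)\<^sup>2)"
    unfolding pred by (intro sum.cong) (simp_all add: comp power2_eq_square algebra_simps)
  also have "\<dots> = real r * ((real n)\<^sup>2 - real n) + (2 * real n - 1) * real j + (\<Sum>i=1..r. (d i)\<^sup>2)"
    using sd by (simp add: sum.distrib sum_distrib_left[symmetric])
  finally have eq: "(real (N * (N - 1)) - (\<Sum>i=1..r. real (composition r j n k i * (composition r j n k i - 1)))) / 2
      = ((real N)\<^sup>2 - real N - (real r * ((real n)\<^sup>2 - real n) + (2 * real n - 1) * real j
          + (\<Sum>i=1..r. (d i)\<^sup>2))) / 2"
    unfolding pred by simp
  show ?thesis
    unfolding eq F_form_deviation[OF assms(1,2)] d_def[symmetric] u_exp_def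
    using assms(1) by (cases "j = 0") (simp_all add: N_def field_simps power2_eq_square)
qed

text \<open>The normalisation removes \<open>u_exp\<close>, so \<open>n\<close> remains only in the
  Pochhammer quotient and in the range of summation.\<close>

lemma galois_number_eq_sum:
  fixes \<delta> :: complex
  defines "x \<equiv> exp (- \<delta>)"
  assumes "r \<ge> 2" "j < r" "norm x < 1"
  shows "galois_number r (r * n + j) (exp \<delta>) * exp (- of_real (u_exp j r n) * \<delta>)
           = (\<Sum>k\<in>admissible r j n. exp (- of_real (F_form r j k) * \<delta>) * (qpoch x (r * n + j)
                * (\<Prod>i=1..r. inverse (qpoch x (nat (int n + deviation r j k i))))))"
proof -
  define N where "N = r * n + j"
  have "galois_number r N (exp \<delta>)
      = (\<Sum>K | K \<in> {1..r} \<rightarrow>\<^sub>E UNIV \<and> (\<Sum>i=1..r. K i) = N. eval_int (exp \<delta>) (q_multinomial r N K))"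
    by (simp add: galois_number_def galois_poly_def eval_int_def[symmetric])
  also have "\<dots> = (\<Sum>k\<in>admissible r j n. eval_int (exp \<delta>) (q_multinomial r N (composition r j n k)))"
    unfolding N_def by (rule sum.reindex_bij_betw[OF bij_betw_composition[OF assms(3)], symmetric])
  finally have "galois_number r N (exp \<delta>) * exp (- of_real (u_exp j r n) * \<delta>)
      = (\<Sum>k\<in>admissible r j n. eval_int (exp \<delta>) (q_multinomial r N (composition r j n k))
           * exp (- of_real (u_exp j r n) * \<delta>))"
    by (simp add: sum_distrib_right)
  also have "\<dots> = (\<Sum>k\<in>admissible r j n. exp (- of_real (F_form r j k) * \<delta>) * (qpoch x N
                * (\<Prod>i=1..r. inverse (qpoch x (nat (int n + deviation r j k i))))))"
  proof (rule sum.cong[OF refl])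
    fix k assume k: "k \<in> admissible r j n"
    let ?K = "composition r j n k"
    have "(of_nat (N * (N - 1)) - (\<Sum>i=1..r. of_nat (?K i * (?K i - 1)))) / 2
        = complex_of_real ((real (N * (N - 1)) - (\<Sum>i=1..r. real (?K i * (?K i - 1)))) / 2)"
      by (simp only: of_real_divide of_real_diff of_real_sum of_real_of_nat_eq of_real_numeral)
    also have "\<dots> = of_real (u_exp j r n) - of_real (F_form r j k)"
      unfolding N_def exponent_composition[OF assms(2,3) k] by simp
    finally have ex: "(of_nat (N * (N - 1)) - (\<Sum>i=1..r. of_nat (?K i * (?K i - 1)))) / 2
        = of_real (u_exp j r n) - (of_real (F_form r j k) :: complex)" .
    have ee: "exp ((of_real (u_exp j r n) - of_real (F_form r j k)) * \<delta>) * exp (- of_real (u_exp j r n) * \<delta>)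
        = exp (- of_real (F_form r j k) * \<delta>)"
      by (simp add: exp_add[symmetric] algebra_simps)
    have "eval_int (exp \<delta>) (q_multinomial r N ?K)
        = exp ((of_real (u_exp j r n) - of_real (F_form r j k)) * \<delta>)
          * (qpoch x N * (\<Prod>i=1..r. inverse (qpoch x (?K i))))"
      unfolding ex[symmetric] x_def
      by (rule eval_q_multinomial)
         (use assms(4) sum_composition[OF assms(3) k] in \<open>simp_all add: x_def N_def\<close>)
    moreover have "(\<Prod>i=1..r. inverse (qpoch x (?K i)))
        = (\<Prod>i=1..r. inverse (qpoch x (nat (int n + deviation r j k i))))"
      by (simp add: composition_def)
    ultimately show "eval_int (exp \<delta>) (q_multinomial r N ?K) * exp (- of_real (u_exp j r n) * \<delta>)
        = exp (- of_real (F_form r j k) * \<delta>) * (qpoch x N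
            * (\<Prod>i=1..r. inverse (qpoch x (nat (int n + deviation r j k i)))))"
      by (simp only: ee[symmetric]) (simp only: mult_ac)
  qed
  finally show ?thesis
    by (simp add: N_def)
qed

section \<open>Convergence of the theta series\<close>

text \<open>On integers \<open>\<bar>m\<bar> \<le> m^2\<close>, so two geometric series, one for
  each sign, dominate.\<close>

lemma summable_on_int_gaussian:
  fixes a :: real
  assumes "a > 0"
  shows "(\<lambda>m::int. exp (- a * (real_of_int m)\<^sup>2)) summable_on UNIV"
proof -
  let ?f = "\<lambda>m::int. exp (- a * \<bar>real_of_int m\<bar>)"
  have "summable (\<lambda>n. norm (exp (- a) ^ n))"
    using assms by (simp add: norm_power)
  then have "(\<lambda>n. exp (- a) ^ n) summable_on UNIV"
    by (rule norm_summable_imp_summable_on)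
  then have nat: "(\<lambda>n. exp (- a * real n)) summable_on UNIV"
    by (simp add: exp_of_nat_mult[symmetric] mult.commute)
  have "?f summable_on range int"
    using nat by (subst summable_on_reindex) (auto simp: o_def)
  moreover have "?f summable_on range (\<lambda>n. - int n)"
    using nat by (subst summable_on_reindex) (auto simp: o_def inj_on_def)
  ultimately have "?f summable_on (range int \<union> range (\<lambda>n. - int n))"
    by (rule summable_on_union)
  also have "range int \<union> range (\<lambda>n. - int n) = UNIV"
    by (auto intro: int_cases2)
  finally have "?f summable_on UNIV" .
  then show ?thesis
  proof (rule summable_on_comparison_test)
    fix m :: int
    have "\<bar>real_of_int m\<bar> \<le> (real_of_int m)\<^sup>2"
    proof -
      have "\<bar>m\<bar> * 1 \<le> \<bar>m\<bar> * \<bar>m\<bar>" if "m \<noteq> 0"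
        using that by (intro mult_left_mono) auto
      then have "\<bar>m\<bar> \<le> m\<^sup>2"
        by (cases "m = 0") (simp_all add: power2_eq_square)
      then show ?thesis
        by (metis of_int_abs of_int_le_iff of_int_power)
    qed
    then show "exp (- a * (real_of_int m)\<^sup>2) \<le> ?f m"
      using assms by simp
  qed auto
qed

text \<open>Partial sums of the first \<open>r - 1\<close> deviations already determine
  \<open>k\<close>, which turns them into independent coordinates for the theta series.\<close>

lemma inj_on_deviation:
  "inj_on (\<lambda>k. \<lambda>i\<in>{1..r-1}. deviation r j k i) ({1..r-1} \<rightarrow>\<^sub>E UNIV)"
proof (rule inj_onI)
  fix k k' :: "nat \<Rightarrow> int"
  assume kk: "k \<in> {1..r-1} \<rightarrow>\<^sub>E UNIV" "k' \<in> {1..r-1} \<rightarrow>\<^sub>E UNIV"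
    and eq: "(\<lambda>i\<in>{1..r-1}. deviation r j k i) = (\<lambda>i\<in>{1..r-1}. deviation r j k' i)"
  have dev: "deviation r j k i = deviation r j k' i" if "i \<in> {1..r-1}" for i
    using fun_cong[OF eq, of i] that by simp
  show "k = k'"
  proof (rule PiE_ext[OF kk])
    fix l assume l: "l \<in> {1..r-1}"
    have "(\<Sum>i=1..l. deviation r j k i) = (\<Sum>i=1..l. deviation r j k' i)"
      using l by (intro sum.cong dev) auto
    then show "k l = k' l"
      using l unfolding sum_deviation by (simp add: pad_def)
  qed
qed

text \<open>Up to a constant, \<open>F_form\<close> is bounded below by half the sum of squares of
  the first \<open>r - 1\<close> deviations. In these coordinates the majorant is a product of
  one-dimensional Gaussians, restricted to the image of an injection.\<close>

lemma summable_on_theta: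
  fixes a :: real
  assumes "r \<ge> 2" "j < r" "a > 0"
  shows "(\<lambda>k. exp (- a * F_form r j k)) summable_on ({1..r-1} \<rightarrow>\<^sub>E UNIV)"
proof -
  let ?A = "{1..r-1} \<rightarrow>\<^sub>E (UNIV :: int set)"
  let ?h = "\<lambda>k. \<lambda>i\<in>{1..r-1}. deviation r j k i"
  let ?P = "\<lambda>d::nat \<Rightarrow> int. \<Prod>i=1..r-1. exp (- (a / 2) * (real_of_int (d i))\<^sup>2)"
  have "(\<lambda>m::int. norm (exp (- (a / 2) * (real_of_int m)\<^sup>2))) summable_on UNIV"
    using summable_on_int_gaussian[of "a / 2"] assms by simp
  then have "Infinite_Set_Sum.abs_summable_on ?P ?A"
    by (intro abs_summable_on_prod_PiE) (auto simp: abs_summable_equivalent[symmetric])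
  then have "?P summable_on ?A"
    by (simp add: abs_summable_equivalent[symmetric] abs_summable_summable)
  then have "?P summable_on ?h ` ?A"
    by (rule summable_on_subset_banach) auto
  then have "(?P \<circ> ?h) summable_on ?A"
    by (simp only: summable_on_reindex[OF inj_on_deviation])
  then have "(\<lambda>k. exp (a * real j / 2) * (?P \<circ> ?h) k) summable_on ?A"
    by (rule summable_on_cmult_right)
  then show ?thesis
  proof (rule summable_on_comparison_test)
    fix k :: "nat \<Rightarrow> int"
    let ?s = "\<Sum>i=1..r-1. (real_of_int (deviation r j k i))\<^sup>2"
    \<comment> \<open>Discarding the square at \<open>i = r\<close>, and then the nonnegative 1/4,
      only lowers the form.\<close>
    have "?s \<le> (\<Sum>i=1..r. (real_of_int (deviation r j k i))\<^sup>2)"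
      by (rule sum_mono2) auto
    then have "(?s - real j) / 2 \<le> F_form r j k"
      unfolding F_form_deviation[OF assms(1,2)] by (auto simp: field_simps)
    then have "a * ((?s - real j) / 2) \<le> a * F_form r j k"
      using assms(3) by (intro mult_left_mono) auto
    then have "exp (- a * F_form r j k) \<le> exp (a * real j / 2 + (\<Sum>i=1..r-1. - (a / 2) * (real_of_int (deviation r j k i))\<^sup>2))"
      unfolding sum_distrib_left[symmetric] by (simp add: field_simps)
    also have "\<dots> = exp (a * real j / 2) * (?P \<circ> ?h) k"
      unfolding exp_add by (simp add: exp_sum)
    finally show "exp (- a * F_form r j k) \<le> exp (a * real j / 2) * (?P \<circ> ?h) k" .
  qed auto
qed

section \<open>The limit by dominated convergence\<close>

theorem theorem3p2:
  fixes r j :: nat and \<delta> :: complex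
  assumes "r \<ge> 2" and "j < r"
    and "\<delta> \<in> (\<lambda>z. - 2 * of_real pi * \<i> * z) ` upper_half_plane"
  shows "(\<lambda>n. galois_number r (r * n + j) (exp \<delta>) * exp (- of_real (u_exp j r n) * \<delta>))
           \<longlonglongrightarrow> theta (r - 1) (F_form r j) (- \<delta> / (2 * of_real pi * \<i>)) / phi (exp (- \<delta>)) ^ (r - 1)"
proof -
  define x where "x = exp (- \<delta>)"
  define A where "A = {1..r-1} \<rightarrow>\<^sub>E (UNIV :: int set)"
  define e where "e k = exp (- of_real (F_form r j k) * \<delta>)" for k
  define w where "w n k = qpoch x (r * n + j)
      * (\<Prod>i=1..r. inverse (qpoch x (nat (int n + deviation r j k i))))" for n k
  \<comment> \<open>Extension by zero puts the sums for all \<open>n\<close> over the same index set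
    \<open>A\<close>.\<close>
  define f where "f n k = (if k \<in> admissible r j n then e k * w n k else 0)" for n k
  have re: "Re \<delta> > 0"
    using assms(3) unfolding mem_upper_half_plane_image_iff .
  then have x: "norm x < 1"
    by (simp add: x_def)
  have inv: "(\<lambda>m. inverse (qpoch x m)) \<longlonglongrightarrow> inverse (phi x)"
    by (rule tendsto_inverse[OF qpoch_tendsto_phi[OF x] phi_nonzero[OF x]])
  \<comment> \<open>Convergent sequences are bounded, so \<open>C * D ^ r\<close> dominates
    \<open>w n k\<close> uniformly in both \<open>n\<close> and \<open>k\<close>.\<close>
  obtain C where C: "\<And>m. norm (qpoch x m) \<le> C"
    using convergent_imp_Bseq[OF convergentI[OF qpoch_tendsto_phi[OF x]]] by (auto simp: Bseq_def)
  obtain D where D: "\<And>m. norm (inverse (qpoch x m)) \<le> D"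
    using convergent_imp_Bseq[OF convergentI[OF inv]] by (auto simp: Bseq_def)
  have CD: "C \<ge> 0" "D \<ge> 0"
    using C[of 0] D[of 0] norm_ge_zero order_trans by blast+
  have norm_e: "norm (e k) = exp (- Re \<delta> * F_form r j k)" for k
    by (simp add: e_def mult.commute)

  have "(\<lambda>n. infsum (f n) A) \<longlonglongrightarrow> infsum (\<lambda>k. e k * (phi x * inverse (phi x) ^ r)) A"
  proof (rule tannery_infsum)
    show "(\<lambda>k. exp (- Re \<delta> * F_form r j k) * (C * D ^ r)) summable_on A"
      unfolding A_def by (intro summable_on_cmult_left summable_on_theta assms re)
  next
    fix n k
    have "norm (\<Prod>i=1..r. inverse (qpoch x (nat (int n + deviation r j k i)))) \<le> (\<Prod>i=1..r. D)"
      unfolding prod_norm[symmetric] by (intro prod_mono conjI norm_ge_zero D)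
    then have "norm (w n k) \<le> C * D ^ r"
      unfolding w_def norm_mult by (intro mult_mono C) (use CD in auto)
    then show "norm (f n k) \<le> exp (- Re \<delta> * F_form r j k) * (C * D ^ r)"
      using CD by (auto simp: f_def norm_mult norm_e intro!: mult_left_mono)
  next
    fix k assume k: "k \<in> A"
    have lim: "filterlim (\<lambda>n. nat (int n + d)) at_top sequentially" for d
      unfolding filterlim_at_top eventually_sequentially
    proof
      fix Z :: nat
      show "\<exists>N. \<forall>n\<ge>N. Z \<le> nat (int n + d)"
        by (rule exI[of _ "Z + nat \<bar>d\<bar>"]) linarith
    qed
    have "filterlim (\<lambda>n. r * n + j) at_top sequentially"
      unfolding filterlim_at_top eventually_sequentially
    proof
      fix Z :: nat
      have "Z \<le> r * n + j" if "n \<ge> Z" for n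
        using that assms(1) mult_le_mono[of 1 r Z n] by simp
      then show "\<exists>N. \<forall>n\<ge>N. Z \<le> r * n + j" by blast
    qed
    then have "(\<lambda>n. w n k) \<longlonglongrightarrow> phi x * (\<Prod>i=1..r. inverse (phi x))"
      unfolding w_def
      by (intro tendsto_mult tendsto_prod filterlim_compose[OF qpoch_tendsto_phi[OF x]]
          filterlim_compose[OF inv] lim)
    then have "(\<lambda>n. e k * w n k) \<longlonglongrightarrow> e k * (phi x * inverse (phi x) ^ r)"
      by (auto intro: tendsto_mult)
    moreover have "\<forall>\<^sub>F n in sequentially. e k * w n k = f n k"
    proof (rule eventually_sequentiallyI)
      \<comment> \<open>From this \<open>n\<close> on, no deviation can make a part negative, so
        \<open>k\<close> is admissible.\<close>
      fix n assume n: "n \<ge> nat (\<Sum>i=1..r. \<bar>deviation r j k i\<bar>)"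
      have "0 \<le> int n + deviation r j k i" if "i \<in> {1..r}" for i
        using member_le_sum[OF that, of "\<lambda>i. \<bar>deviation r j k i\<bar>"] n by simp
      then show "e k * w n k = f n k"
        using k by (simp add: f_def admissible_def A_def)
    qed
    ultimately show "(\<lambda>n. f n k) \<longlonglongrightarrow> e k * (phi x * inverse (phi x) ^ r)"
      by (rule Lim_transform_eventually)
  qed
  moreover have "infsum (f n) A = galois_number r (r * n + j) (exp \<delta>) * exp (- of_real (u_exp j r n) * \<delta>)" for n
  proof -
    have "infsum (f n) A = infsum (\<lambda>k. e k * w n k) (admissible r j n)"
      by (rule infsum_cong_neutral) (auto simp: f_def admissible_def A_def)
    also have "\<dots> = (\<Sum>k\<in>admissible r j n. e k * w n k)"
      by (simp add: finite_admissible assms)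
    also have "\<dots> = galois_number r (r * n + j) (exp \<delta>) * exp (- of_real (u_exp j r n) * \<delta>)"
      using galois_number_eq_sum[OF assms(1,2), of \<delta> n] x by (simp add: e_def w_def x_def)
    finally show ?thesis .
  qed
  moreover have "infsum (\<lambda>k. e k * (phi x * inverse (phi x) ^ r)) A
      = theta (r - 1) (F_form r j) (- \<delta> / (2 * of_real pi * \<i>)) / phi x ^ (r - 1)"
  proof -
    \<comment> \<open>At \<open>z = - \<delta> / (2 * pi * i)\<close> the factor
      \<open>2 * pi * i * z\<close> is \<open>- \<delta>\<close>, so the terms agree one by
      one.\<close>
    have "infsum e A = theta (r - 1) (F_form r j) (- \<delta> / (2 * of_real pi * \<i>))"
      unfolding theta_def A_def e_def
      by (intro infsum_cong arg_cong[where f = exp]) (simp add: field_simps)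
    \<comment> \<open>The numerator \<open>qpoch x (r * n + j)\<close> contributes one
      \<open>phi x\<close>, which cancels one of the \<open>r\<close> in the denominator.\<close>
    moreover have "phi x * inverse (phi x) ^ r = inverse (phi x ^ (r - 1))"
      using phi_nonzero[OF x] assms(1) by (cases r) (simp_all add: power_inverse)
    ultimately show ?thesis
      by (simp only: infsum_cmult_left' divide_inverse)
  qed
  ultimately show ?thesis
    by (simp add: x_def)
qed

end
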